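(* Let $f_p,g_p,V,\sigma,c$ satisfy the standing assumptions in the context, and let $u_p^*$ be the min-norm controller defined there. Assume that the learned controller has the form $$\hat u(x,\theta)=\sum_{k=1}^K\theta_k u_k(x),$$ where $u_1,\dots,u_K:\mathbb{R}^n\to\mathbb{R}^m$ are locally Lipschitz continuous and $\theta_k$ is the $k$-th entry of $\theta$, and that the set $\{u_k\}_{k=1}^K$ (restricted to $W^c$) is linearly independent in the vector space $C(W^c,\mathbb{R}^m)$ of continuous functions from $W^c$ to $\mathbb{R}^m$. Further assume that $\Theta\subset\mathbb{R}^K$ is convex and that there exists $\theta^*\in\Theta$ such that $\hat u(x,\theta^* )=u_p^*(x)$ for each $x\in W^c$. Then there exists $\bar\lambda\in\mathbb{R}_{\ge0}$ such that for each $\lambda>\bar\lambda$ the problem $\mathbf{P}_\lambda:\ \min_{\theta\in\Theta}L_\lambda(\theta)$ is a strongly convex optimization problem (minimization of a strongly convex function over a convex set) with $\theta^*$ its unique global minimizer.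
   Context: Setting. Consider the control-affine system (plant) $\dot x=f_p(x)+g_p(x)u$ with state $x\in\mathbb{R}^n$ and input $u\in\mathbb{R}^m$, where $f_p:\mathbb{R}^n\to\mathbb{R}^n$, $g_p:\mathbb{R}^n\to\mathbb{R}^{n\times m}$ and $f_p(0)=0$. Let $V:\mathbb{R}^n\to\mathbb{R}_{\ge 0}$ be continuously differentiable, positive definite ($V(0)=0$ and $V(x)>0$ for $x\ne0$) and radially unbounded ($V(x)\to\infty$ as $\|x\|\to\infty$), with gradient $\nabla V(x)\in\mathbb{R}^{1\times n}$ regarded as a row vector, and let $\sigma:\mathbb{R}^n\to\mathbb{R}_{\ge0}$ be positive definite. Fix $c>0$ and let $W^c=\{x\in\mathbb{R}^n: V(x)\le c\}$. Standing assumptions. (i) $f_p$, $g_p$, $\sigma$ and $\nabla V$ are locally Lipschitz continuous. (ii) There exists a locally Lipschitz continuous $\tilde u_p:\mathbb{R}^n\to\mathbb{R}^m$ such that $\nabla V(x)[f_p(x)+g_p(x)\tilde u_p(x)]\le-\sigma(x)$ for each $x\in W^c$. Min-norm controller. For $x\in W^c$, $$u_p^*(x)=\operatorname{argmin}_{u\in\mathbb{R}^m}\|u\|_2^2\quad\text{subject to}\quad \nabla V(x)[f_p(x)+g_p(x)u]\le-\sigma(x).$$ Loss. For a learned controller $\hat u:\mathbb{R}^n\times\Theta\to\mathbb{R}^m$ with parameter set $\Theta\subset\mathbb{R}^K$ define $\Delta(x,\theta)=\nabla V(x)[f_p(x)+g_p(x)\hat u(x,\theta)]+\sigma(x)$ and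 $H(y)=\max\{0,y\}$ for $y\in\mathbb{R}$. For $\lambda\in\mathbb{R}_{\ge0}$ let $$L_\lambda(\theta)=E_{x\sim X}\big[\|\hat u(x,\theta)\|_2^2+\lambda H(\Delta(x,\theta))\big],$$ where $X$ is the uniform probability distribution on $W^c$. *)

theory Defs
  imports "HOL-Analysis.Analysis"
begin

definition locally_lipschitz :: "('a::metric_space \<Rightarrow> 'b::metric_space) \<Rightarrow> bool" where
  "locally_lipschitz f \<longleftrightarrow> (\<forall>x. \<exists>r>0. \<exists>L. L-lipschitz_on (cball x r) f)"

definition positive_definite :: "('a::zero \<Rightarrow> real) \<Rightarrow> bool" where
  "positive_definite V \<longleftrightarrow> V 0 = 0 \<and> (\<forall>x. x \<noteq> 0 \<longrightarrow> V x > 0)"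

definition sublevel :: "('a \<Rightarrow> real) \<Rightarrow> real \<Rightarrow> 'a set" where
  "sublevel V c = {x. V x \<le> c}"

text \<open>
  Throughout, \<open>DV\<close> stands for the gradient of \<open>V\<close>, so that the row vector \<open>DV x\<close> times a column
  vector is written as an inner product. A matrix of type \<open>real ^ 'm ^ 'n\<close> has rows indexed by
  \<open>'n\<close> and columns indexed by \<open>'m\<close>.
\<close>

definition decrease_constraint ::
  "(real ^ 'n \<Rightarrow> real ^ 'n) \<Rightarrow> (real ^ 'n \<Rightarrow> real ^ 'm ^ 'n) \<Rightarrow> (real ^ 'n \<Rightarrow> real ^ 'n) \<Rightarrow>
   (real ^ 'n \<Rightarrow> real) \<Rightarrow> real ^ 'n \<Rightarrow> real ^ 'm \<Rightarrow> bool" where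
  "decrease_constraint fp gp DV \<sigma> x u \<longleftrightarrow> DV x \<bullet> (fp x + gp x *v u) \<le> - \<sigma> x"

text \<open>
  \<open>arg_min\<close> picks some minimizer. Whenever the constraint is feasible the minimizer exists and is
  unique (it is the point of least norm of a nonempty closed half-space or of the whole space).
\<close>

definition min_norm_controller ::
  "(real ^ 'n \<Rightarrow> real ^ 'n) \<Rightarrow> (real ^ 'n \<Rightarrow> real ^ 'm ^ 'n) \<Rightarrow> (real ^ 'n \<Rightarrow> real ^ 'n) \<Rightarrow>
   (real ^ 'n \<Rightarrow> real) \<Rightarrow> real ^ 'n \<Rightarrow> real ^ 'm" where
  "min_norm_controller fp gp DV \<sigma> x =
     arg_min (\<lambda>u. (norm u)\<^sup>2) (decrease_constraint fp gp DV \<sigma> x)"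

definition violation ::
  "(real ^ 'n \<Rightarrow> real ^ 'n) \<Rightarrow> (real ^ 'n \<Rightarrow> real ^ 'm ^ 'n) \<Rightarrow> (real ^ 'n \<Rightarrow> real ^ 'n) \<Rightarrow>
   (real ^ 'n \<Rightarrow> real) \<Rightarrow> (real ^ 'n \<Rightarrow> real ^ 'k \<Rightarrow> real ^ 'm) \<Rightarrow>
   real ^ 'n \<Rightarrow> real ^ 'k \<Rightarrow> real" where
  "violation fp gp DV \<sigma> uhat x \<theta> = DV x \<bullet> (fp x + gp x *v uhat x \<theta>) + \<sigma> x"

definition hinge :: "real \<Rightarrow> real" where
  "hinge y = max 0 y"

definition loss ::
  "(real ^ 'n \<Rightarrow> real ^ 'n) \<Rightarrow> (real ^ 'n \<Rightarrow> real ^ 'm ^ 'n) \<Rightarrow> (real ^ 'n \<Rightarrow> real ^ 'n) \<Rightarrow>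
   (real ^ 'n \<Rightarrow> real) \<Rightarrow> (real ^ 'n) set \<Rightarrow> (real ^ 'n \<Rightarrow> real ^ 'k \<Rightarrow> real ^ 'm) \<Rightarrow>
   real \<Rightarrow> real ^ 'k \<Rightarrow> real" where
  "loss fp gp DV \<sigma> W uhat lam \<theta> =
     (\<integral>x. (norm (uhat x \<theta>))\<^sup>2 + lam * hinge (violation fp gp DV \<sigma> uhat x \<theta>)
        \<partial>uniform_measure lborel W)"

definition linear_controller ::
  "('k \<Rightarrow> real ^ 'n \<Rightarrow> real ^ 'm) \<Rightarrow> real ^ 'n \<Rightarrow> real ^ 'k \<Rightarrow> real ^ 'm" where
  "linear_controller u x \<theta> = (\<Sum>k\<in>UNIV. \<theta> $ k *\<^sub>R u k x)"

text \<open>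
  Linear independence of the family of restrictions of the \<open>u k\<close> to \<open>W\<close>, in the vector space of
  functions on \<open>W\<close>, whose zero vector is the function vanishing on all of \<open>W\<close>.
\<close>

definition lin_indep_on ::
  "'a set \<Rightarrow> ('k::finite \<Rightarrow> 'a \<Rightarrow> 'b::real_vector) \<Rightarrow> bool" where
  "lin_indep_on W u \<longleftrightarrow>
     (\<forall>a :: 'k \<Rightarrow> real. (\<forall>x\<in>W. (\<Sum>k\<in>UNIV. a k *\<^sub>R u k x) = 0) \<longrightarrow> (\<forall>k. a k = 0))"

definition strongly_convex_on :: "'a::real_normed_vector set \<Rightarrow> ('a \<Rightarrow> real) \<Rightarrow> bool" where
  "strongly_convex_on S f \<longleftrightarrow> convex S \<and>
     (\<exists>\<mu>>0. \<forall>x\<in>S. \<forall>y\<in>S. \<forall>t\<in>{0..1}.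
        f ((1 - t) *\<^sub>R x + t *\<^sub>R y)
          \<le> (1 - t) * f x + t * f y - \<mu> / 2 * t * (1 - t) * (norm (x - y))\<^sup>2)"

end

theory Submission
  imports Defs "HOL-Probability.Probability"
begin

text \<open>
  Write \<open>d = \<theta> - \<theta>s\<close>, let \<open>v\<^sub>d\<close> be the linear controller with parameter \<open>d\<close>, and let \<open>a\<close> be the
  normal vector of the constraint half-space at \<open>x\<close>. Wherever the min-norm input \<open>u\<^sup>*\<close> is nonzero,
  the constraint is active and \<open>u\<^sup>* = - r a\<close> with \<open>r > 0\<close>, so the violation at \<open>\<theta>\<close> is \<open>a \<bullet> v\<^sub>d\<close>
  there. The amount \<open>-2 u\<^sup>* \<bullet> v\<^sub>d\<close> by which the cross term lowers the squared norm is the positive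
  multiple \<open>2 r (a \<bullet> v\<^sub>d)\<close> of it.
  The factor \<open>r\<close> need not be bounded near the origin, so no pointwise penalty bound is available.
  In mean, however, the linear functional \<open>N d = E (-2 u\<^sup>* \<bullet> v\<^sub>d)\<close> is dominated by a multiple of
  \<open>P d = E (max 0 (a \<bullet> v\<^sub>d))\<close> (over the points with \<open>u\<^sup>* \<noteq> 0\<close>): modulo the subspace on which
  \<open>a \<bullet> v\<^sub>d\<close> vanishes almost everywhere, \<open>P d = 0\<close> forces \<open>N d < 0\<close>, and the unit sphere is compact.

  Strong convexity comes from \<open>E (norm v\<^sub>d)\<^sup>2\<close>, which is positive definite because the boundary of
  the sublevel set lies in the closure of its interior: the decrease constraint excludes critical
  points of \<open>V\<close> other than the origin.
\<close>

text \<open>The constant is the minimum of \<open>f\<close> over the compact unit sphere, and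
  homogeneity carries the bound from \<open>sgn x\<close> to \<open>x\<close>.\<close>

lemma homogeneous_quadratic_lower_bound:
  fixes f :: "'a::euclidean_space \<Rightarrow> real"
  assumes cont: "continuous_on UNIV f"
    and hom: "\<And>t x. f (t *\<^sub>R x) = t\<^sup>2 * f x"
    and pos: "\<And>x. x \<noteq> 0 \<Longrightarrow> f x > 0"
  shows "\<exists>m>0. \<forall>x. m * (norm x)\<^sup>2 \<le> f x"
proof -
  have "compact (sphere (0::'a) 1)" "sphere (0::'a) 1 \<noteq> {}" "continuous_on (sphere 0 1) f"
    using cont continuous_on_subset by auto
  then obtain z where z: "z \<in> sphere 0 1" "\<And>y. y \<in> sphere 0 1 \<Longrightarrow> f z \<le> f y"
    using continuous_attains_inf by metis
  have "f z * (norm x)\<^sup>2 \<le> f x" for x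
  proof (cases "x = 0")
    case True
    then show ?thesis using hom[of 0 0] by simp
  next
    case False
    then have "f z \<le> f (sgn x)" by (intro z) (simp add: norm_sgn)
    then have "f z * (norm x)\<^sup>2 \<le> f (norm x *\<^sub>R sgn x)"
      by (subst hom) (simp add: mult.commute mult_right_mono)
    then show ?thesis using False by (simp add: sgn_div_norm)
  qed
  moreover have "f z > 0" using z(1) by (intro pos) auto
  ultimately show ?thesis by blast
qed

section \<open>Convexity of integrals and of the hinge\<close>

lemma convex_on_integral:
  fixes g :: "'e::real_vector \<Rightarrow> 'a \<Rightarrow> real"
  assumes int: "\<And>d. integrable M (g d)"
    and conv: "\<And>x. convex_on UNIV (\<lambda>d. g d x)"
  shows "convex_on UNIV (\<lambda>d. \<integral>x. g d x \<partial>M)"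
proof (rule convex_onI)
  fix t :: real and y z :: 'e
  assume t: "0 < t" "t < 1"
  have "(\<integral>x. g ((1 - t) *\<^sub>R y + t *\<^sub>R z) x \<partial>M) \<le> (\<integral>x. (1 - t) * g y x + t * g z x \<partial>M)"
    using t by (intro integral_mono int Bochner_Integration.integrable_add integrable_mult_right)
      (auto intro!: convex_onD[OF conv])
  also have "\<dots> = (1 - t) * (\<integral>x. g y x \<partial>M) + t * (\<integral>x. g z x \<partial>M)"
    using int by simp
  finally show "(\<integral>x. g ((1 - t) *\<^sub>R y + t *\<^sub>R z) x \<partial>M)
      \<le> (1 - t) * (\<integral>x. g y x \<partial>M) + t * (\<integral>x. g z x \<partial>M)" .
qed auto

lemma convex_on_hinge_linear:
  fixes l :: "'e::real_vector \<Rightarrow> real"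
  assumes "linear l"
  shows "convex_on UNIV (\<lambda>d. hinge (l d + b))"
proof (rule convex_onI)
  fix t :: real and y z :: 'e
  assume t: "0 < t" "t < 1"
  have "0 \<le> (1 - t) * hinge (l y + b) + t * hinge (l z + b)"
    using t by (simp add: hinge_def)
  moreover have "(1 - t) * (l y + b) + t * (l z + b) \<le> (1 - t) * hinge (l y + b) + t * hinge (l z + b)"
    using t by (intro add_mono mult_left_mono) (auto simp: hinge_def)
  moreover have "l ((1 - t) *\<^sub>R y + t *\<^sub>R z) + b = (1 - t) * (l y + b) + t * (l z + b)"
    unfolding linear_add[OF assms] linear_scale[OF assms] by (simp add: algebra_simps)
  ultimately show "hinge (l ((1 - t) *\<^sub>R y + t *\<^sub>R z) + b)
      \<le> (1 - t) * hinge (l y + b) + t * hinge (l z + b)"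
    by (simp add: hinge_def)
qed auto

lemma norm_convex_combination_sq:
  fixes p q :: "'a::real_inner"
  shows "(norm ((1 - t) *\<^sub>R p + t *\<^sub>R q))\<^sup>2
    = (1 - t) * (norm p)\<^sup>2 + t * (norm q)\<^sup>2 - t * (1 - t) * (norm (p - q))\<^sup>2"
  unfolding power2_norm_eq_inner
  by (simp add: inner_add inner_diff inner_commute[of q p]) (simp add: algebra_simps power2_eq_square)

text \<open>The factor \<open>r\<close> varies with the point and may be unbounded, so only its sign
  is used: \<open>n d\<close> and \<open>w d\<close> have the same sign and the same zeros almost
  everywhere. Both integrals are positively homogeneous in \<open>d\<close>, and compactness of a
  part of the unit sphere supplies the uniform constant.\<close>

lemma integral_linear_le_hinge:
  fixes n w :: "'e::euclidean_space \<Rightarrow> 'a \<Rightarrow> real"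
  assumes lin_n: "\<And>x. linear (\<lambda>d. n d x)" and lin_w: "\<And>x. linear (\<lambda>d. w d x)"
    and int_n: "\<And>d. integrable M (n d)" and int_w: "\<And>d. integrable M (w d)"
    and multiple: "AE x in M. \<exists>r>0. \<forall>d. n d x = r * w d x"
  shows "\<exists>C\<ge>0. \<forall>d. (\<integral>x. n d x \<partial>M) \<le> C * (\<integral>x. hinge (w d x) \<partial>M)"
proof -
  define N where "N d = (\<integral>x. n d x \<partial>M)" for d
  define P where "P d = (\<integral>x. hinge (w d x) \<partial>M)" for d
  have n_add: "n (y + z) = (\<lambda>x. n y x + n z x)" and n_scale: "n (t *\<^sub>R y) = (\<lambda>x. t * n y x)" for y z t
    by (simp_all add: fun_eq_iff linear_add[OF lin_n] linear_scale[OF lin_n])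
  have N_lin: "linear N"
    unfolding N_def by (rule linearI) (simp_all add: n_add n_scale int_n)
  have int_h: "integrable M (\<lambda>x. hinge (w d x))" for d
    unfolding hinge_def by (intro integrable_max int_w) simp
  have P_nonneg: "P d \<ge> 0" for d
    unfolding P_def by (intro Bochner_Integration.integral_nonneg) (simp add: hinge_def)
  \<comment> \<open>A finite convex function on a finite-dimensional space is continuous.\<close>
  have P_cont: "continuous_on UNIV P"
    unfolding P_def
    by (intro convex_on_continuous convex_on_integral int_h)
      (use convex_on_hinge_linear[OF lin_w, of _ 0] in auto)
  have N_cont: "continuous_on UNIV N"
    using N_lin by (simp add: linear_continuous_on linear_linear)
  have P_scale: "P (t *\<^sub>R d) = t * P d" if "t \<ge> 0" for t d
  proof -
    have "hinge (t * y) = t * hinge y" for y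
      using that by (simp add: hinge_def max_mult_distrib_left)
    then show ?thesis unfolding P_def by (simp add: linear_scale[OF lin_w])
  qed
  \<comment> \<open>Adding a direction in \<open>L\<close> changes neither \<open>N\<close> nor
    \<open>P\<close>, so the estimate only has to be proved on the orthogonal complement of
    \<open>L\<close>.\<close>
  define L where "L = {d. AE x in M. w d x = 0}"
  have subL: "subspace L"
  proof (rule subspaceI)
    show "0 \<in> L" by (simp add: L_def linear_0[OF lin_w])
  next
    fix x y assume "x \<in> L" "y \<in> L"
    then show "x + y \<in> L" unfolding L_def mem_Collect_eq
      by eventually_elim (simp add: linear_add[OF lin_w])
  next
    fix t x assume "x \<in> L"
    then show "t *\<^sub>R x \<in> L" unfolding L_def mem_Collect_eq
      by eventually_elim (simp add: linear_scale[OF lin_w])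
  qed
  have mod_L: "N (y + z) = N z" "P (y + z) = P z" if "y \<in> L" for y z
  proof -
    have y: "AE x in M. w y x = 0" using that by (simp add: L_def)
    show "P (y + z) = P z"
      unfolding P_def
    proof (rule integral_cong_AE)
      show "AE x in M. hinge (w (y + z) x) = hinge (w z x)"
        using y by eventually_elim (simp add: linear_add[OF lin_w])
    qed (rule borel_measurable_integrable[OF int_h])+
    have "AE x in M. n y x = 0" using multiple y by eventually_elim auto
    then have "AE x in M. n (y + z) x = n z x"
      by eventually_elim (simp add: n_add)
    then show "N (y + z) = N z"
      unfolding N_def by (intro integral_cong_AE borel_measurable_integrable[OF int_n])
  qed
  \<comment> \<open>\<open>P d = 0\<close> makes \<open>w d\<close>, and with it \<open>n d\<close>,
    nonpositive almost everywhere; a nonnegative integral of \<open>n d\<close> then forces both to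
    vanish almost everywhere.\<close>
  have key: "d \<in> L" if "P d = 0" "N d \<ge> 0" for d
  proof -
    have "AE x in M. hinge (w d x) = 0"
      using that(1) int_h unfolding P_def
      by (subst integral_nonneg_eq_0_iff_AE[symmetric]) (auto simp: hinge_def)
    then have w: "AE x in M. w d x \<le> 0"
      by eventually_elim (simp add: hinge_def)
    have n: "AE x in M. 0 \<le> - n d x"
      using multiple w by eventually_elim (auto simp: mult_nonneg_nonpos)
    have "(\<integral>x. - n d x \<partial>M) = 0"
      using that(2) integral_nonneg_AE[OF n] by (simp add: N_def)
    then have "AE x in M. - n d x = 0"
      using integral_nonneg_eq_0_iff_AE[OF _ n] int_n by simp
    then have "AE x in M. w d x = 0"
      using multiple by eventually_elim auto
    then show ?thesis by (simp add: L_def)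
  qed
  \<comment> \<open>Only directions with \<open>0 \<le> N z\<close> need a bound, since
    \<open>C * P z\<close> is never negative. The weak inequality keeps \<open>S\<close> closed, and
    by \<open>key\<close> the function \<open>P\<close> has no zero on \<open>S\<close>, so the
    ratio \<open>N z / P z\<close> attains a maximum there, unless \<open>S\<close> is empty and any
    \<open>C\<close> will do.\<close>
  define S where "S = sphere 0 1 \<inter> {z. \<forall>y\<in>L. orthogonal y z} \<inter> {z. 0 \<le> N z}"
  have "compact S"
    unfolding S_def
    by (intro compact_Int_closed compact_sphere closed_subspace subspace_orthogonal_to_vectors
        closed_Collect_le continuous_intros N_cont)
  have P_pos: "P z > 0" if "z \<in> S" for z
  proof (rule ccontr)
    assume "\<not> P z > 0"
    then have "z \<in> L" using that P_nonneg[of z] key[of z] by (auto simp: S_def)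
    then show False using that by (auto simp: S_def orthogonal_def)
  qed
  obtain C where C: "C \<ge> 0" "\<And>z. z \<in> S \<Longrightarrow> N z \<le> C * P z"
  proof (cases "S = {}")
    case True
    then show ?thesis using that[of 0] by auto
  next
    case False
    have cont: "continuous_on S (\<lambda>z. N z / P z)"
      by (intro continuous_on_divide continuous_on_subset[OF N_cont] continuous_on_subset[OF P_cont])
        (use P_pos in force)+
    obtain z0 where z0: "z0 \<in> S" "\<And>z. z \<in> S \<Longrightarrow> N z / P z \<le> N z0 / P z0"
      using continuous_attains_sup[OF \<open>compact S\<close> False cont] by blast
    show ?thesis
    proof (rule that[of "N z0 / P z0"])
      show "0 \<le> N z0 / P z0" using z0(1) P_pos[OF z0(1)] by (auto simp: S_def)
      show "N z \<le> N z0 / P z0 * P z" if "z \<in> S" for z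
        using z0(2)[OF that] P_pos[OF that] by (simp add: pos_divide_le_eq)
    qed
  qed
  have "N d \<le> C * P d" for d
  proof -
    obtain y z where yz: "y \<in> span L" "\<And>v. v \<in> span L \<Longrightarrow> orthogonal z v" "d = y + z"
      using orthogonal_subspace_decomp_exists by metis
    have y: "y \<in> L" using yz(1) subL by (simp add: span_eq_iff[THEN iffD2])
    have "N z \<le> C * P z"
    \<comment> \<open>In the first case \<open>sgn z\<close> lies in \<open>S\<close> and the bound
      is rescaled; otherwise \<open>N z \<le> 0\<close> and nothing is left to show.\<close>
    proof (cases "N z \<ge> 0 \<and> z \<noteq> 0")
      case True
      have sgn: "sgn z = inverse (norm z) *\<^sub>R z" by (simp add: sgn_div_norm)
      have N_sgn: "N (sgn z) = inverse (norm z) * N z"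
        unfolding sgn by (simp add: linear_scale[OF N_lin])
      have P_sgn: "P (sgn z) = inverse (norm z) * P z"
        unfolding sgn by (rule P_scale) simp
      have "orthogonal v (sgn z)" if "v \<in> L" for v
        using yz(2)[OF span_base[OF that]] by (simp add: orthogonal_def sgn inner_commute)
      then have "sgn z \<in> S"
        using True by (simp add: S_def N_sgn norm_sgn)
      then have "inverse (norm z) * N z \<le> inverse (norm z) * (C * P z)"
        using C(2)[of "sgn z"] by (simp add: N_sgn P_sgn mult.left_commute)
      then show ?thesis using True by simp
    next
      case False
      then have "N z \<le> 0" using linear_0[OF N_lin] by fastforce
      then show ?thesis using C(1) P_nonneg[of z] by (meson mult_nonneg_nonneg order_trans)
    qed
    then show ?thesis using mod_L[OF y] yz(3) by simp
  qed
  then show ?thesis using C(1) unfolding N_def P_def by blast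
qed

text \<open>A nonzero minimizer means that the origin is infeasible, so \<open>b < 0\<close>, and
  the minimizer must be the projection \<open>z\<close> of the origin onto the bounding hyperplane.
  Expanding \<open>(v - z) \<bullet> (v - z)\<close> shows this.\<close>

lemma least_norm_in_halfspace:
  fixes a v :: "'a::real_inner"
  assumes feas: "a \<bullet> v \<le> b" and least: "\<And>y. a \<bullet> y \<le> b \<Longrightarrow> norm v \<le> norm y" and "v \<noteq> 0"
  shows "a \<bullet> v = b \<and> (\<exists>r>0. v = - r *\<^sub>R a)"
proof -
  have b: "b < 0"
    using least[of 0] \<open>v \<noteq> 0\<close> by (force simp: not_le)
  then have "a \<noteq> 0" using feas by auto
  then have aa: "a \<bullet> a > 0" by simp
  define z where "z = (b / (a \<bullet> a)) *\<^sub>R a"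
  have az: "a \<bullet> z = b" using aa by (simp add: z_def)
  have zz: "z \<bullet> z = b / (a \<bullet> a) * b" using aa by (simp add: z_def)
  have vz: "v \<bullet> z = b / (a \<bullet> a) * (a \<bullet> v)" by (simp add: z_def inner_commute)
  have "z \<bullet> z \<le> v \<bullet> z"
    unfolding zz vz using b aa feas by (meson divide_nonpos_pos less_imp_le mult_left_mono_neg)
  moreover have "v \<bullet> v \<le> z \<bullet> z"
    using least[of z] az by (simp add: norm_le)
  ultimately have "(v - z) \<bullet> (v - z) \<le> 0"
    by (simp add: inner_diff inner_commute)
  then have "v = z" by (metis inner_gt_zero_iff eq_iff_diff_eq_0 not_le)
  moreover have "z = - (- b / (a \<bullet> a)) *\<^sub>R a" by (simp add: z_def)
  moreover have "- b / (a \<bullet> a) > 0" using b aa by (intro divide_pos_pos) simp_all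
  ultimately show ?thesis using az by blast
qed

lemma decrease_constraint_iff:
  "decrease_constraint fp gp DV \<sigma> x u \<longleftrightarrow> (DV x v* gp x) \<bullet> u \<le> - \<sigma> x - DV x \<bullet> fp x"
  unfolding decrease_constraint_def dot_lmul_matrix by (auto simp: inner_add_right)

text \<open>The value of \<open>arg_min\<close> is meaningful only once a minimizer exists; here it
  is the point of a nonempty closed half-space or whole space closest to the origin.\<close>

lemma min_norm_controller_least:
  assumes "decrease_constraint fp gp DV \<sigma> x v"
  shows "decrease_constraint fp gp DV \<sigma> x (min_norm_controller fp gp DV \<sigma> x)"
    and "decrease_constraint fp gp DV \<sigma> x y \<Longrightarrow> norm (min_norm_controller fp gp DV \<sigma> x) \<le> norm y"
proof -
  let ?S = "Collect (decrease_constraint fp gp DV \<sigma> x)"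
  have "closed ?S" unfolding decrease_constraint_iff by (rule closed_halfspace_le)
  moreover have "?S \<noteq> {}" using assms by auto
  ultimately obtain p where p: "p \<in> ?S" "\<And>y. y \<in> ?S \<Longrightarrow> dist 0 p \<le> dist 0 y"
    using distance_attains_inf by metis
  have "decrease_constraint fp gp DV \<sigma> x (min_norm_controller fp gp DV \<sigma> x) \<and>
    (\<forall>y. decrease_constraint fp gp DV \<sigma> x y \<longrightarrow> norm (min_norm_controller fp gp DV \<sigma> x) \<le> norm y)"
    unfolding min_norm_controller_def
    by (rule arg_minI[where x = p])
      (use p in \<open>auto simp: not_less intro: power_mono dest!: power2_le_imp_le\<close>)
  then show "decrease_constraint fp gp DV \<sigma> x (min_norm_controller fp gp DV \<sigma> x)"
    and "decrease_constraint fp gp DV \<sigma> x y \<Longrightarrow> norm (min_norm_controller fp gp DV \<sigma> x) \<le> norm y"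
    by auto
qed

section \<open>Continuity, null sets and sublevel sets\<close>

lemma locally_lipschitz_continuous:
  assumes "locally_lipschitz f"
  shows "continuous_on UNIV f"
proof (rule continuous_at_imp_continuous_on, rule ballI)
  fix x
  obtain r L where "r > 0" "L-lipschitz_on (cball x r) f"
    using assms unfolding locally_lipschitz_def by blast
  then have "continuous_on (ball x r) f"
    by (meson ball_subset_cball continuous_on_subset lipschitz_on_continuous_on)
  then show "isCont f x"
    using \<open>r > 0\<close> by (simp add: continuous_on_eq_continuous_at)
qed

text \<open>The points of \<open>S\<close> where \<open>f\<close> is nonzero form an open null set,
  and a nonempty open set is not negligible.\<close>

lemma AE_zero_on_open:
  fixes f :: "'a::euclidean_space \<Rightarrow> real"
  assumes "open S" "continuous_on UNIV f" "AE x in lborel. x \<in> S \<longrightarrow> f x = 0" "x \<in> S"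
  shows "f x = 0"
proof (rule ccontr)
  assume nz: "f x \<noteq> 0"
  let ?T = "S \<inter> {x. f x \<noteq> 0}"
  have op: "open ?T"
    using assms(1,2) by (intro open_Int open_Collect_neq) auto
  then have "?T \<in> null_sets lborel"
    using assms(3) by (subst AE_iff_null_sets) (auto elim: eventually_mono)
  then have "negligible ?T"
    by (simp add: negligible_iff_null_sets null_sets_completionI)
  then show False
    using open_not_negligible[OF op] nz assms(4) by blast
qed

lemma compact_sublevel:
  fixes V :: "'a::euclidean_space \<Rightarrow> real"
  assumes "continuous_on UNIV V" "filterlim V at_top at_infinity"
  shows "compact (sublevel V c)"
proof -
  have "eventually (\<lambda>x. V x > c) at_infinity"
    using assms(2) by (simp add: filterlim_at_top_dense)
  then obtain b where "\<And>x. norm x \<ge> b \<Longrightarrow> V x > c"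
    by (auto simp: eventually_at_infinity)
  then have "norm x \<le> b" if "x \<in> sublevel V c" for x
    using that unfolding sublevel_def by (metis linorder_not_less mem_Collect_eq nle_le)
  then have "bounded (sublevel V c)" by (rule boundedI)
  moreover have "closed (sublevel V c)"
    unfolding sublevel_def using assms(1) by (intro closed_Collect_le continuous_intros)
  ultimately show ?thesis by (simp add: compact_eq_bounded_closed)
qed

text \<open>Along the ray from \<open>x\<close> in direction \<open>y\<close>, \<open>V\<close>
  drops strictly below \<open>V x\<close> at once, and these points tend to
  \<open>x\<close>.\<close>

lemma GDERIV_descent_in_closure:
  assumes "GDERIV V x :> g" "g \<bullet> y < 0"
  shows "x \<in> closure {z. V z < V x}"
proof -
  have "((\<lambda>t. x + t *\<^sub>R y) has_derivative (\<lambda>t. t *\<^sub>R y)) (at 0)"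
    by (auto intro!: derivative_eq_intros)
  moreover have "(V has_derivative (\<lambda>h. h \<bullet> g)) (at (x + 0 *\<^sub>R y))"
    using assms(1) by (simp add: gderiv_def)
  ultimately have "((\<lambda>t. V (x + t *\<^sub>R y)) has_derivative (\<lambda>t. (t *\<^sub>R y) \<bullet> g)) (at 0)"
    by (rule has_derivative_compose)
  then have "((\<lambda>t. V (x + t *\<^sub>R y)) has_real_derivative (g \<bullet> y)) (at 0)"
    unfolding has_field_derivative_def
    by (rule has_derivative_eq_rhs) (simp add: fun_eq_iff inner_commute)
  from DERIV_neg_dec_right[OF this assms(2)] obtain e where
    e: "e > 0" "\<forall>t>0. t < e \<longrightarrow> V (x + t *\<^sub>R y) < V x"
    by (metis add_0 add.right_neutral scaleR_zero_left)
  have ev: "eventually (\<lambda>t. x + t *\<^sub>R y \<in> closure {z. V z < V x}) (at_right 0)"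
    unfolding eventually_at_right_field
    using e by (intro exI[of _ e]) (auto intro!: subsetD[OF closure_subset])
  have "((\<lambda>t. x + t *\<^sub>R y) \<longlongrightarrow> x + 0 *\<^sub>R y) (at_right (0::real))"
    by (intro tendsto_intros)
  then show ?thesis
    using Lim_in_closed_set[OF closed_closure ev] by simp
qed

section \<open>Integrability under the uniform measure on a compact set\<close>

lemma integrable_uniform_measure_bounded:
  fixes f :: "'a::euclidean_space \<Rightarrow> real"
  assumes W: "compact W" "emeasure lborel W \<noteq> 0"
    and f: "f \<in> borel_measurable borel" and bd: "\<And>x. x \<in> W \<Longrightarrow> \<bar>f x\<bar> \<le> B"
  shows "integrable (uniform_measure lborel W) f"
proof -
  have "emeasure lborel W \<noteq> \<infinity>"
    using emeasure_compact_finite[OF W(1)] by simp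
  then interpret prob_space "uniform_measure lborel W"
    using W by (intro prob_space_uniform_measure) auto
  have "AE x in uniform_measure lborel W. norm (f x) \<le> B"
    using W(1) bd by (intro AE_uniform_measureI) (auto simp: compact_imp_closed)
  then show ?thesis
    by (rule integrable_const_bound) (use f in \<open>simp cong: measurable_cong_sets\<close>)
qed

lemma integrable_uniform_measure_continuous:
  fixes f :: "'a::euclidean_space \<Rightarrow> real"
  assumes W: "compact W" "emeasure lborel W \<noteq> 0" and f: "continuous_on UNIV f"
  shows "integrable (uniform_measure lborel W) f"
proof -
  have "bounded (f ` W)"
    using W f by (meson compact_continuous_image compact_imp_bounded continuous_on_subset subset_UNIV)
  then obtain B where "\<And>x. x \<in> W \<Longrightarrow> \<bar>f x\<bar> \<le> B"
    by (auto simp: bounded_iff)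
  then show ?thesis
    using W f by (intro integrable_uniform_measure_bounded borel_measurable_continuous_onI)
qed

lemma linear_linear_controller: "linear (linear_controller u x)"
  by (rule linearI)
    (simp_all add: linear_controller_def scaleR_left_distrib sum.distrib scaleR_sum_right)

theorem theorem2:
  fixes fp :: "real ^ 'n \<Rightarrow> real ^ 'n"
    and gp :: "real ^ 'n \<Rightarrow> real ^ 'm ^ 'n"
    and V \<sigma> :: "real ^ 'n \<Rightarrow> real"
    and DV :: "real ^ 'n \<Rightarrow> real ^ 'n"
    and c :: real
    and u :: "'k::finite \<Rightarrow> real ^ 'n \<Rightarrow> real ^ 'm"
    and \<Theta> :: "(real ^ 'k) set"
    and \<theta>s :: "real ^ 'k"
  assumes "fp 0 = 0"
    and "\<forall>x. GDERIV V x :> DV x" and "continuous_on UNIV DV"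
    and "positive_definite V" and "filterlim V at_top at_infinity"
    and "positive_definite \<sigma>"
    and "c > 0"
    and "locally_lipschitz fp" and "locally_lipschitz gp"
    and "locally_lipschitz \<sigma>" and "locally_lipschitz DV"
    and "\<exists>ut :: real ^ 'n \<Rightarrow> real ^ 'm. locally_lipschitz ut \<and>
           (\<forall>x\<in>sublevel V c. decrease_constraint fp gp DV \<sigma> x (ut x))"
    and "\<forall>k. locally_lipschitz (u k)"
    and "lin_indep_on (sublevel V c) u"
    and "convex \<Theta>"
    and "\<theta>s \<in> \<Theta>"
    and "\<forall>x\<in>sublevel V c. linear_controller u x \<theta>s = min_norm_controller fp gp DV \<sigma> x"
  shows "\<exists>lbar\<ge>0. \<forall>lam>lbar.
           strongly_convex_on \<Theta> (loss fp gp DV \<sigma> (sublevel V c) (linear_controller u) lam) \<and>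
           (\<forall>\<theta>. is_arg_min (loss fp gp DV \<sigma> (sublevel V c) (linear_controller u) lam)
                   (\<lambda>\<theta>. \<theta> \<in> \<Theta>) \<theta> \<longleftrightarrow> \<theta> = \<theta>s)"
proof -

  \<comment> \<open>The constraint as a half-space of inputs; feasibility and continuity\<close>
  let ?W = "sublevel V c" and ?U = "{x. V x < c}"
  let ?uh = "linear_controller u"
  let ?\<nu> = "uniform_measure lborel ?W"
  define a where "a x = DV x v* gp x" for x
  define b where "b x = DV x \<bullet> fp x + \<sigma> x" for x
  have violation_eq: "violation fp gp DV \<sigma> ?uh x \<theta> = a x \<bullet> ?uh x \<theta> + b x" for x \<theta>
    unfolding violation_def a_def b_def dot_lmul_matrix by (simp add: inner_add_right)
  have constraint_iff: "decrease_constraint fp gp DV \<sigma> x v \<longleftrightarrow> a x \<bullet> v \<le> - b x" for x v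
    unfolding decrease_constraint_iff a_def b_def by auto

  have feasible: "\<exists>v. decrease_constraint fp gp DV \<sigma> x v" if "x \<in> ?W" for x
  proof -
    obtain ut where "\<forall>x\<in>?W. decrease_constraint fp gp DV \<sigma> x (ut x)"
      using assms(12) by (elim exE conjE)
    then show ?thesis using that by (intro exI) (rule bspec)
  qed
  have contV: "continuous_on UNIV V"
    using assms(2) unfolding gderiv_def
    by (meson continuous_at_imp_continuous_on has_derivative_continuous)
  have cont_comp: "continuous_on UNIV fp" "continuous_on UNIV gp" "continuous_on UNIV \<sigma>"
    "\<And>k. continuous_on UNIV (u k)"
    using assms(8-10,13) locally_lipschitz_continuous by blast+
  have cont_a: "continuous_on UNIV a"
    unfolding a_def vector_matrix_mult_def
    by (intro continuous_intros cont_comp assms(3))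
  have cont_b: "continuous_on UNIV b"
    unfolding b_def by (intro continuous_intros cont_comp assms(3))
  have cont_uh: "continuous_on UNIV (\<lambda>x. ?uh x \<theta>)" for \<theta>
    unfolding linear_controller_def by (intro continuous_intros cont_comp)
  have cont_hinge: "continuous_on UNIV (\<lambda>x. hinge (a x \<bullet> ?uh x \<theta> + b x))" for \<theta>
    unfolding hinge_def by (intro continuous_intros cont_a cont_b cont_uh)
  have cont_sq: "continuous_on UNIV (\<lambda>x. (norm (?uh x \<theta>))\<^sup>2)" for \<theta>
    by (intro continuous_intros cont_uh)

  \<comment> \<open>Measure and topology of the sublevel set\<close>
  have compW: "compact ?W" using compact_sublevel[OF contV assms(5)] .
  have openU: "open ?U" using contV by (intro open_Collect_less continuous_intros)
  have UW: "x \<in> ?W" if "x \<in> ?U" for x using that by (simp add: sublevel_def)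
  have "0 \<in> ?U" using assms(4,7) by (simp add: positive_definite_def)
  have W_pos: "emeasure lborel ?W \<noteq> 0"
  proof
    assume "emeasure lborel ?W = 0"
    then have "?W \<in> null_sets lborel"
      using compW by (intro null_setsI) (auto simp: compact_imp_closed)
    then have "AE x in lborel. x \<notin> ?W" by (rule AE_not_in)
    then have "AE x in lborel. x \<in> ?U \<longrightarrow> (1::real) = 0"
      by (rule eventually_mono) (use UW in blast)
    then show False
      using AE_zero_on_open[OF openU _ _ \<open>0 \<in> ?U\<close>, of "\<lambda>_. 1"] by simp
  qed
  have W_fin: "emeasure lborel ?W < \<infinity>" using emeasure_compact_finite[OF compW] by simp
  note AE_\<nu> = AE_uniform_measure[OF W_pos W_fin]
  note int_cont = integrable_uniform_measure_continuous[OF compW W_pos]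
  have W_closure: "x \<in> closure ?U" if "x \<in> ?W" for x
  proof (cases "V x < c")
    case True
    then show ?thesis using closure_subset[of ?U] by auto
  next
    \<comment> \<open>On the level set \<open>V x = c\<close> the state is nonzero, so
      \<open>\<sigma> x > 0\<close>, and the closed-loop velocity under a feasible input is a strict
      descent direction of \<open>V\<close>.\<close>
    case False
    then have Vx: "V x = c" using that by (simp add: sublevel_def)
    then have "x \<noteq> 0" using assms(4,7) by (auto simp: positive_definite_def)
    then have "\<sigma> x > 0" using assms(6) by (simp add: positive_definite_def)
    moreover from feasible[OF that] obtain v where "DV x \<bullet> (fp x + gp x *v v) \<le> - \<sigma> x"
      unfolding decrease_constraint_def by blast
    ultimately have "DV x \<bullet> (fp x + gp x *v v) < 0" by linarith
    then show ?thesis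
      using GDERIV_descent_in_closure[OF assms(2)[rule_format, of x]] Vx by simp
  qed

  \<comment> \<open>The loss as a quadratic form plus a penalty\<close>
  define Q where "Q \<theta> = (\<integral>x. (norm (?uh x \<theta>))\<^sup>2 \<partial>?\<nu>)" for \<theta>
  define R where "R \<theta> = (\<integral>x. hinge (a x \<bullet> ?uh x \<theta> + b x) \<partial>?\<nu>)" for \<theta>
  have loss_eq: "loss fp gp DV \<sigma> ?W ?uh lam \<theta> = Q \<theta> + lam * R \<theta>" for lam \<theta>
    unfolding loss_def violation_eq Q_def R_def
    using int_cont[OF cont_sq] int_cont[OF cont_hinge] by simp
  note lin = linear_linear_controller[of u]
  \<comment> \<open>The convexity defect of a quadratic form is an exact expression; the strong
    convexity is read off from it.\<close>
  have Q_comb: "Q ((1 - t) *\<^sub>R x + t *\<^sub>R y) = (1 - t) * Q x + t * Q y - t * (1 - t) * Q (x - y)" for t x y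
    unfolding Q_def
    by (simp add: linear_add[OF lin] linear_scale[OF lin] linear_diff[OF lin, symmetric]
        norm_convex_combination_sq int_cont[OF cont_sq])
  have Q_nonneg: "Q \<theta> \<ge> 0" for \<theta> unfolding Q_def by simp
  have "convex_on UNIV Q"
    by (rule convex_onI) (simp_all add: Q_comb Q_nonneg)
  then have contQ: "continuous_on UNIV Q" by (intro convex_on_continuous) auto
  \<comment> \<open>Vanishing almost everywhere becomes vanishing on the open set \<open>?U\<close>,
    then by continuity on its closure, which contains \<open>?W\<close>; linear independence
    finishes.\<close>
  have Q_pos: "Q d > 0" if "d \<noteq> 0" for d
  proof (rule ccontr)
    assume "\<not> Q d > 0"
    then have "Q d = 0" using Q_nonneg[of d] by simp
    then have "AE x in ?\<nu>. (norm (?uh x d))\<^sup>2 = 0"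
      unfolding Q_def using int_cont[OF cont_sq]
      by (subst (asm) integral_nonneg_eq_0_iff_AE) auto
    then have "AE x in lborel. x \<in> ?U \<longrightarrow> (norm (?uh x d))\<^sup>2 = 0"
      unfolding AE_\<nu> by (rule eventually_mono) (use UW in auto)
    then have zU: "(norm (?uh x d))\<^sup>2 = 0" if "x \<in> ?U" for x
      using AE_zero_on_open[OF openU cont_sq _ that] by blast
    have "?uh x d = 0" if "x \<in> ?W" for x
      using continuous_constant_on_closure[of ?U "\<lambda>x. ?uh x d" 0 x] W_closure[OF that] zU
        continuous_on_subset[OF cont_uh] by auto
    then have "\<forall>k. d $ k = 0"
      using assms(14) unfolding lin_indep_on_def linear_controller_def by blast
    then show False using that by (simp add: vec_eq_iff)
  qed
  have "Q (t *\<^sub>R d) = t\<^sup>2 * Q d" for t d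
    unfolding Q_def by (simp add: linear_scale[OF lin] power_mult_distrib)
  then obtain m where m: "m > 0" "\<And>d. m * (norm d)\<^sup>2 \<le> Q d"
    using homogeneous_quadratic_lower_bound[OF contQ _ Q_pos] by blast

  \<comment> \<open>The min-norm input and the penalty bound\<close>
  define us where "us x = ?uh x \<theta>s" for x
  have us_feas: "a x \<bullet> us x \<le> - b x"
    and us_least: "\<And>v. a x \<bullet> v \<le> - b x \<Longrightarrow> norm (us x) \<le> norm v" if x: "x \<in> ?W" for x
  proof -
    obtain v where "decrease_constraint fp gp DV \<sigma> x v" using feasible[OF x] by blast
    from min_norm_controller_least[OF this] assms(17) x
    show "a x \<bullet> us x \<le> - b x" "\<And>v. a x \<bullet> v \<le> - b x \<Longrightarrow> norm (us x) \<le> norm v"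
      by (auto simp: us_def constraint_iff)
  qed
  have us_active: "a x \<bullet> us x = - b x \<and> (\<exists>r>0. us x = - r *\<^sub>R a x)" if "x \<in> ?W" "us x \<noteq> 0" for x
    using least_norm_in_halfspace[OF us_feas us_least] that by blast

  define n where "n d x = - 2 * (us x \<bullet> ?uh x d)" for d x
  \<comment> \<open>The indicator selects the points where the constraint is known to be active.
    Elsewhere it may be slack, but there \<open>n\<close> vanishes too.\<close>
  define w where "w d x = indicator {x. us x \<noteq> 0} x * (a x \<bullet> ?uh x d)" for d x
  have cont_us: "continuous_on UNIV us" unfolding us_def by (rule cont_uh)
  have int_n: "integrable ?\<nu> (n d)" for d
    unfolding n_def by (intro int_cont continuous_intros cont_us cont_uh)
  \<comment> \<open>The indicator may destroy continuity, so integrability comes from boundedness on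
    \<open>?W\<close> and measurability.\<close>
  have int_w: "integrable ?\<nu> (w d)" for d
  proof -
    have cont: "continuous_on UNIV (\<lambda>x. a x \<bullet> ?uh x d)"
      by (intro continuous_intros cont_a cont_uh)
    then have "bounded ((\<lambda>x. a x \<bullet> ?uh x d) ` ?W)"
      using compW by (meson compact_continuous_image compact_imp_bounded continuous_on_subset subset_UNIV)
    then obtain B where B: "\<And>x. x \<in> ?W \<Longrightarrow> \<bar>a x \<bullet> ?uh x d\<bar> \<le> B"
      by (auto simp: bounded_iff)
    have "open {x. us x \<noteq> 0}"
      using cont_us by (intro open_Collect_neq) auto
    then have "w d \<in> borel_measurable borel"
      unfolding w_def using borel_measurable_continuous_onI[OF cont]
      by (intro borel_measurable_times borel_measurable_indicator) auto
    moreover have "\<bar>w d x\<bar> \<le> B" if "x \<in> ?W" for x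
      using B[OF that] by (auto simp: w_def indicator_def)
    ultimately show ?thesis
      by (intro integrable_uniform_measure_bounded[OF compW W_pos])
  qed
  have "AE x in ?\<nu>. \<exists>r>0. \<forall>d. n d x = r * w d x"
    unfolding AE_\<nu>
  proof (rule AE_I2, rule impI)
    fix x assume x: "x \<in> ?W"
    show "\<exists>r>0. \<forall>d. n d x = r * w d x"
    proof (cases "us x = 0")
      case True
      \<comment> \<open>Both sides are zero, so any positive factor serves.\<close>
      then show ?thesis by (intro exI[of _ 1]) (simp add: n_def w_def)
    next
      case False
      then obtain r where "r > 0" "us x = - r *\<^sub>R a x" using us_active[OF x] by blast
      then show ?thesis using False by (intro exI[of _ "2 * r"]) (simp add: n_def w_def)
    qed
  qed
  moreover have "linear (\<lambda>d. n d x)" "linear (\<lambda>d. w d x)" for x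
    by (auto intro!: linearI simp: n_def w_def linear_add[OF lin] linear_scale[OF lin] algebra_simps)
  ultimately obtain C where C: "C \<ge> 0" "\<And>d. (\<integral>x. n d x \<partial>?\<nu>) \<le> C * (\<integral>x. hinge (w d x) \<partial>?\<nu>)"
    using integral_linear_le_hinge[of n w ?\<nu>] int_n int_w by blast

  \<comment> \<open>Quadratic growth of the loss away from \<open>\<theta>s\<close>\<close>
  have R_s: "R \<theta>s = 0"
  proof -
    have "AE x in ?\<nu>. hinge (a x \<bullet> ?uh x \<theta>s + b x) = 0"
      unfolding AE_\<nu> using us_feas by (force simp: hinge_def us_def)
    then show ?thesis unfolding R_def by (rule integral_eq_zero_AE)
  qed
  have R_ge: "(\<integral>x. hinge (w (\<theta> - \<theta>s) x) \<partial>?\<nu>) \<le> R \<theta>" for \<theta>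
    unfolding R_def
  proof (rule integral_mono_AE)
    show "integrable ?\<nu> (\<lambda>x. hinge (w (\<theta> - \<theta>s) x))"
      unfolding hinge_def by (intro integrable_max int_w) (use int_cont in simp)
    show "integrable ?\<nu> (\<lambda>x. hinge (a x \<bullet> ?uh x \<theta> + b x))"
      by (intro int_cont cont_hinge)
    show "AE x in ?\<nu>. hinge (w (\<theta> - \<theta>s) x) \<le> hinge (a x \<bullet> ?uh x \<theta> + b x)"
      unfolding AE_\<nu>
    proof (rule AE_I2, rule impI)
      fix x assume x: "x \<in> ?W"
      show "hinge (w (\<theta> - \<theta>s) x) \<le> hinge (a x \<bullet> ?uh x \<theta> + b x)"
      proof (cases "us x = 0")
        case True
        then show ?thesis by (simp add: w_def hinge_def)
      next
        case False
        \<comment> \<open>Activity gives \<open>b x = - (a x \<bullet> us x)\<close>, so both hinges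
          have the same argument.\<close>
        then show ?thesis using us_active[OF x]
          by (simp add: w_def linear_diff[OF lin] inner_diff_right us_def[symmetric])
      qed
    qed
  qed
  have Q_diff: "Q \<theta> = Q \<theta>s + Q (\<theta> - \<theta>s) - (\<integral>x. n (\<theta> - \<theta>s) x \<partial>?\<nu>)" for \<theta>
  proof -
    have "(norm (?uh x \<theta>))\<^sup>2 = (norm (?uh x \<theta>s))\<^sup>2 + (norm (?uh x (\<theta> - \<theta>s)))\<^sup>2 - n (\<theta> - \<theta>s) x" for x
      unfolding n_def us_def power2_norm_eq_inner linear_diff[OF lin]
      by (simp add: inner_diff inner_commute[of "?uh x \<theta>" "?uh x \<theta>s"])
    then show ?thesis
      unfolding Q_def using int_cont[OF cont_sq] int_n by simp
  qed
  \<comment> \<open>The linear term of \<open>Q_diff\<close> is at most \<open>C\<close> times the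
    mean hinge of \<open>w\<close>, hence at most \<open>lam * R \<theta>\<close>; what remains is
    \<open>Q (\<theta> - \<theta>s)\<close>. This makes \<open>C\<close> the threshold and yields
    both minimality and uniqueness.\<close>
  have growth: "loss fp gp DV \<sigma> ?W ?uh lam \<theta>s + m * (norm (\<theta> - \<theta>s))\<^sup>2 \<le> loss fp gp DV \<sigma> ?W ?uh lam \<theta>"
    if "lam > C" for lam \<theta>
  proof -
    let ?P = "\<integral>x. hinge (w (\<theta> - \<theta>s) x) \<partial>?\<nu>"
    have "?P \<ge> 0" by (intro Bochner_Integration.integral_nonneg) (simp add: hinge_def)
    then have "C * ?P \<le> lam * R \<theta>"
      using that C(1) R_ge[of \<theta>] by (intro mult_mono) auto
    then show ?thesis
      using C(2)[of "\<theta> - \<theta>s"] m(2)[of "\<theta> - \<theta>s"] Q_diff[of \<theta>] by (simp add: loss_eq R_s)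
  qed

  \<comment> \<open>Strong convexity and the unique minimizer\<close>
  have convR: "convex_on UNIV R"
    unfolding R_def
  proof (rule convex_on_integral)
    show "integrable ?\<nu> (\<lambda>x. hinge (a x \<bullet> ?uh x \<theta> + b x))" for \<theta>
      by (intro int_cont cont_hinge)
    show "convex_on UNIV (\<lambda>\<theta>. hinge (a x \<bullet> ?uh x \<theta> + b x))" for x
      by (rule convex_on_hinge_linear)
        (auto intro!: linearI simp: linear_add[OF lin] linear_scale[OF lin] inner_add_right)
  qed
  have strong: "strongly_convex_on \<Theta> (loss fp gp DV \<sigma> ?W ?uh lam)" if "lam > C" for lam
    unfolding strongly_convex_on_def
  \<comment> \<open>The modulus \<open>2 * m\<close> offsets the factor one half in the definition;
    it comes from \<open>Q\<close> alone, as the penalty is merely convex.\<close>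
  proof (intro conjI exI[of _ "2 * m"] ballI)
    fix x y :: "real ^ 'k" and t :: real
    assume t: "t \<in> {0..1}"
    have "lam * R ((1 - t) *\<^sub>R x + t *\<^sub>R y) \<le> lam * ((1 - t) * R x + t * R y)"
      using that C(1) t by (intro mult_left_mono convex_onD[OF convR]) auto
    moreover have "t * (1 - t) * (m * (norm (x - y))\<^sup>2) \<le> t * (1 - t) * Q (x - y)"
      using t m(2) by (intro mult_left_mono) auto
    ultimately show "loss fp gp DV \<sigma> ?W ?uh lam ((1 - t) *\<^sub>R x + t *\<^sub>R y)
        \<le> (1 - t) * loss fp gp DV \<sigma> ?W ?uh lam x + t * loss fp gp DV \<sigma> ?W ?uh lam y
          - 2 * m / 2 * t * (1 - t) * (norm (x - y))\<^sup>2"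
      unfolding loss_eq Q_comb by (simp add: algebra_simps)
  qed (use assms(15) m(1) in auto)
  have unique: "is_arg_min (loss fp gp DV \<sigma> ?W ?uh lam) (\<lambda>\<theta>. \<theta> \<in> \<Theta>) \<theta> \<longleftrightarrow> \<theta> = \<theta>s"
    if "lam > C" for lam \<theta>
  proof
    assume "is_arg_min (loss fp gp DV \<sigma> ?W ?uh lam) (\<lambda>\<theta>. \<theta> \<in> \<Theta>) \<theta>"
    then have "m * (norm (\<theta> - \<theta>s))\<^sup>2 \<le> 0"
      using growth[OF that, of \<theta>] assms(16) by (force simp: is_arg_min_linorder)
    then show "\<theta> = \<theta>s" using m(1) by (simp add: mult_le_0_iff)
  next
    have "loss fp gp DV \<sigma> ?W ?uh lam \<theta>s \<le> loss fp gp DV \<sigma> ?W ?uh lam y" for y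
      using growth[OF that, of y] m(1) by (smt (verit) mult_nonneg_nonneg zero_le_power2)
    then show "is_arg_min (loss fp gp DV \<sigma> ?W ?uh lam) (\<lambda>\<theta>. \<theta> \<in> \<Theta>) \<theta>" if "\<theta> = \<theta>s"
      using that assms(16) by (simp add: is_arg_min_linorder)
  qed
  show ?thesis
    using C(1) strong unique by blast
qed

end
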